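(* Let $T:\mathfrak h\to\mathfrak g$ be a nonabelian embedding tensor on a Lie algebra $\mathfrak g$ with respect to a coherent action $(\mathfrak h;\rho)$. Then the Lie algebra $(\mathfrak h,[-,-]_{\mathfrak h})$ together with the binary product $\rhd:\mathfrak h\otimes\mathfrak h\to\mathfrak h$ given by $$u\rhd v=\rho(Tu)v,\qquad \forall u,v\in\mathfrak h,$$ is a Leibniz-Lie algebra.
   Context: All vector spaces are over a fixed ground field. A coherent action of a Lie algebra $\mathfrak g$ on a Lie algebra $\mathfrak h$, denoted $(\mathfrak h;\rho)$, is a Lie algebra homomorphism $\rho:\mathfrak g\to\mathrm{Der}(\mathfrak h)$ such that $[\rho(x)u,v]_{\mathfrak h}=0$ for all $x\in\mathfrak g$, $u,v\in\mathfrak h$. A nonabelian embedding tensor on $\mathfrak g$ with respect to $(\mathfrak h;\rho)$ is a linear map $T:\mathfrak h\to\mathfrak g$ with $[Tu,Tv]_{\mathfrak g}=T\big(\rho(Tu)(v)+[u,v]_{\mathfrak h}\big)$ for all $u,v\in\mathfrak h$. A Leibniz-Lie algebra $(\mathfrak h,[-,-]_{\mathfrak h},\rhd)$ consists of a Lie algebra $(\mathfrak h,[-,-]_{\mathfrak h})$ and a bilinear product $\rhd:\mathfrak h\otimes\mathfrak h\to\mathfrak h$ such that for all $x,y,z\in\mathfrak h$: $x\rhd(y\rhd z)=(x\rhd y)\rhd z+y\rhd(x\rhd z)+[x,y]_{\mathfrak h}\rhd z$ and $x\rhd[y,z]_{\mathfrak h}=[x\rhd y,z]_{\mathfrak h}=0$.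 *)

theory Defs
  imports Complex_Main "HOL-Library.Function_Algebras"
begin

definition bilinear_op :: "('k::field \<Rightarrow> 'v::ab_group_add \<Rightarrow> 'v) \<Rightarrow> ('v \<Rightarrow> 'v \<Rightarrow> 'v) \<Rightarrow> bool"
  where "bilinear_op scale p \<longleftrightarrow>
    (\<forall>x. Vector_Spaces.linear scale scale (\<lambda>y. p x y)) \<and>
    (\<forall>y. Vector_Spaces.linear scale scale (\<lambda>x. p x y))"

(* The bracket is alternating, not merely antisymmetric, as is needed in characteristic 2. *)
locale lie_algebra = vector_space scale
  for scale :: "'k::field \<Rightarrow> 'v::ab_group_add \<Rightarrow> 'v" +
  fixes bracket :: "'v \<Rightarrow> 'v \<Rightarrow> 'v"
  assumes bracket_bilinear: "bilinear_op scale bracket"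
    and bracket_self: "bracket x x = 0"
    and jacobi: "bracket x (bracket y z) + bracket y (bracket z x) + bracket z (bracket x y) = 0"

(* Der(V) is a set of functions; addition and subtraction of functions are pointwise
   (Function_Algebras), and fun_scale is the matching scalar multiplication. *)
definition fun_scale :: "('k \<Rightarrow> 'v \<Rightarrow> 'v) \<Rightarrow> 'k \<Rightarrow> ('v \<Rightarrow> 'v) \<Rightarrow> ('v \<Rightarrow> 'v)"
  where "fun_scale scale c D = (\<lambda>u. scale c (D u))"

definition commutator :: "('v::ab_group_add \<Rightarrow> 'v) \<Rightarrow> ('v \<Rightarrow> 'v) \<Rightarrow> ('v \<Rightarrow> 'v)"
  where "commutator D E = (D \<circ> E) - (E \<circ> D)"

definition derivations ::
    "('k::field \<Rightarrow> 'v::ab_group_add \<Rightarrow> 'v) \<Rightarrow> ('v \<Rightarrow> 'v \<Rightarrow> 'v) \<Rightarrow> ('v \<Rightarrow> 'v) set"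
  where "derivations scale bracket =
    {D. Vector_Spaces.linear scale scale D \<and>
        (\<forall>u v. D (bracket u v) = bracket (D u) v + bracket u (D v))}"

lemma vector_space_fun_scale:
  assumes "vector_space scale"
  shows "vector_space (fun_scale scale)"
proof -
  interpret vector_space scale by fact
  show ?thesis
    by unfold_locales
      (simp_all add: fun_scale_def fun_eq_iff scale_right_distrib scale_left_distrib)
qed

(* The second Lie algebra is Der(h): rho is linear into the functions on h, takes values in the
   derivations, and turns the bracket of g into the commutator. *)
locale coherent_action =
  g: lie_algebra scale_g bracket_g + h: lie_algebra scale_h bracket_h
  for scale_g :: "'k::field \<Rightarrow> 'g::ab_group_add \<Rightarrow> 'g"
    and bracket_g :: "'g \<Rightarrow> 'g \<Rightarrow> 'g"
    and scale_h :: "'k \<Rightarrow> 'h::ab_group_add \<Rightarrow> 'h"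
    and bracket_h :: "'h \<Rightarrow> 'h \<Rightarrow> 'h" +
  fixes \<rho> :: "'g \<Rightarrow> 'h \<Rightarrow> 'h"
  assumes rho_derivation: "\<rho> x \<in> derivations scale_h bracket_h"
    and rho_linear: "Vector_Spaces.linear scale_g (fun_scale scale_h) \<rho>"
    and rho_bracket: "\<rho> (bracket_g x y) = commutator (\<rho> x) (\<rho> y)"
    and rho_coherent: "bracket_h (\<rho> x u) v = 0"

locale nonabelian_embedding_tensor =
  coherent_action scale_g bracket_g scale_h bracket_h \<rho>
  for scale_g :: "'k::field \<Rightarrow> 'g::ab_group_add \<Rightarrow> 'g"
    and bracket_g :: "'g \<Rightarrow> 'g \<Rightarrow> 'g"
    and scale_h :: "'k \<Rightarrow> 'h::ab_group_add \<Rightarrow> 'h"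
    and bracket_h :: "'h \<Rightarrow> 'h \<Rightarrow> 'h"
    and \<rho> :: "'g \<Rightarrow> 'h \<Rightarrow> 'h" +
  fixes T :: "'h \<Rightarrow> 'g"
  assumes T_linear: "Vector_Spaces.linear scale_h scale_g T"
    and T_embedding: "bracket_g (T u) (T v) = T (\<rho> (T u) v + bracket_h u v)"

locale leibniz_lie_algebra = lie_algebra scale bracket
  for scale :: "'k::field \<Rightarrow> 'v::ab_group_add \<Rightarrow> 'v"
    and bracket :: "'v \<Rightarrow> 'v \<Rightarrow> 'v" +
  fixes rhd :: "'v \<Rightarrow> 'v \<Rightarrow> 'v"  (infixr "\<rhd>" 75)
  assumes rhd_bilinear: "bilinear_op scale rhd"
    and rhd_leibniz:
      "x \<rhd> (y \<rhd> z) = (x \<rhd> y) \<rhd> z + y \<rhd> (x \<rhd> z) + (bracket x y) \<rhd> z"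
    and rhd_bracket: "x \<rhd> (bracket y z) = 0"
    and bracket_rhd: "bracket (x \<rhd> y) z = 0"

end

theory Submission
  imports Defs
begin

text \<open>
  Write \<open>u \<rhd> v\<close> for \<open>\<rho> (T u) v\<close>. Applying \<open>\<rho>\<close> to the embedding tensor equation and using that
  \<open>\<rho>\<close> takes brackets to commutators and is additive, as is \<open>T\<close>, turns that equation into an
  identity of operators on the Lie algebra acted upon,
  \<open>\<rho> (T u) \<circ> \<rho> (T v) - \<rho> (T v) \<circ> \<rho> (T u) = \<rho> (T (u \<rhd> v)) + \<rho> (T [u, v])\<close>,
  which is the Leibniz-type axiom once it is evaluated at a vector.
  The axiom \<open>[u \<rhd> v, w] = 0\<close> is coherence. For \<open>u \<rhd> [v, w] = 0\<close>, the derivation rule leaves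
  \<open>[u \<rhd> v, w] + [v, u \<rhd> w]\<close>, where the first term vanishes by coherence and the second by
  coherence and antisymmetry.
\<close>

lemma (in lie_algebra) bracket_antisymmetric: "bracket x y = - bracket y x"
proof -
  have add_right: "bracket a (b + c) = bracket a b + bracket a c"
    and add_left: "bracket (b + c) a = bracket b a + bracket c a" for a b c
    using bracket_bilinear by (auto simp: bilinear_op_def Vector_Spaces.linear_iff)
  have "bracket x y + bracket y x = bracket (x + y) (x + y)"
    by (simp add: add_right add_left bracket_self [of x] bracket_self [of y])
  also have "\<dots> = 0"
    by (rule bracket_self)
  finally show ?thesis
    by (simp only: eq_neg_iff_add_eq_0)
qed

text \<open>
  Coherence puts the image of the action in the left annihilator of the bracket; antisymmetry
  puts it in the right annihilator, so the derivation rule makes the action vanish on brackets.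
\<close>

lemma (in coherent_action) rho_kills_bracket: "\<rho> x (bracket_h u v) = 0"
proof -
  have "\<rho> x (bracket_h u v) = bracket_h (\<rho> x u) v + bracket_h u (\<rho> x v)"
    using rho_derivation by (simp add: derivations_def)
  also have "bracket_h u (\<rho> x v) = - bracket_h (\<rho> x v) u"
    by (rule h.bracket_antisymmetric)
  finally show ?thesis
    by (simp add: rho_coherent)
qed

context nonabelian_embedding_tensor
begin

lemma rho_T_add: "\<rho> (T (u + v)) w = \<rho> (T u) w + \<rho> (T v) w"
  using T_linear rho_linear by (simp add: Vector_Spaces.linear_iff)

lemma rho_T_bilinear: "bilinear_op scale_h (\<lambda>u v. \<rho> (T u) v)"
proof -
  have "Vector_Spaces.linear scale_h scale_h (\<rho> (T u))" for u
    using rho_derivation by (simp add: derivations_def)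
  moreover have "Vector_Spaces.linear scale_h scale_h (\<lambda>u. \<rho> (T u) v)" for v
    using T_linear rho_linear by (simp add: Vector_Spaces.linear_iff fun_scale_def)
  ultimately show ?thesis
    by (simp add: bilinear_op_def)
qed

text \<open>
  Both sides of the embedding tensor equation act on \<open>w\<close>: the left one as a commutator, the right
  one as a sum of two operators.
\<close>

lemma rho_T_leibniz:
  "\<rho> (T u) (\<rho> (T v) w)
    = \<rho> (T (\<rho> (T u) v)) w + \<rho> (T v) (\<rho> (T u) w) + \<rho> (T (bracket_h u v)) w"
proof -
  have "\<rho> (T u) (\<rho> (T v) w) - \<rho> (T v) (\<rho> (T u) w) = \<rho> (bracket_g (T u) (T v)) w"
    by (simp add: rho_bracket commutator_def)
  also have "\<dots> = \<rho> (T (\<rho> (T u) v)) w + \<rho> (T (bracket_h u v)) w"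
    by (simp add: T_embedding rho_T_add)
  finally show ?thesis
    by (simp add: algebra_simps)
qed

end

theorem theorem3p5:
  fixes scale_g :: "'k::field \<Rightarrow> 'g::ab_group_add \<Rightarrow> 'g"
    and bracket_g :: "'g \<Rightarrow> 'g \<Rightarrow> 'g"
    and scale_h :: "'k \<Rightarrow> 'h::ab_group_add \<Rightarrow> 'h"
    and bracket_h :: "'h \<Rightarrow> 'h \<Rightarrow> 'h"
    and \<rho> :: "'g \<Rightarrow> 'h \<Rightarrow> 'h"
    and T :: "'h \<Rightarrow> 'g"
  assumes "lie_algebra scale_g bracket_g"
    and "lie_algebra scale_h bracket_h"
    and "coherent_action scale_g bracket_g scale_h bracket_h \<rho>"
    and "nonabelian_embedding_tensor scale_g bracket_g scale_h bracket_h \<rho> T"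
  shows "leibniz_lie_algebra scale_h bracket_h (\<lambda>u v. \<rho> (T u) v)"
proof -
  interpret nonabelian_embedding_tensor scale_g bracket_g scale_h bracket_h \<rho> T
    by fact
  show ?thesis
    by unfold_locales
      (rule rho_T_bilinear rho_T_leibniz rho_kills_bracket rho_coherent)+
qed

end
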